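(* Let $D\subset\mathbb{R}$, $\varepsilon\geq 0$ and assume that a function $f\colon D\to\mathbb{R}$ satisfies $$f(\max\{x,y\})-\min\{f(x),f(y)\}\leq\varepsilon\quad\text{for all }x,y\in D.$$ Then there exists a decreasing function $g\colon D\to \mathbb{R}$ such that $|f(x)-g(x)|\leq\varepsilon/2$ for every $x\in D$.
   Context: "Decreasing" is meant in the weak sense: $g\colon D\to\mathbb{R}$ is decreasing if $x\leq y$ implies $g(x)\geq g(y)$ for $x,y\in D$. *)

theory Defs
  imports Complex_Main
begin

end

(* For x \<le> y the hypothesis reads f y \<le> f x + \<epsilon>, so the least decreasing majorant of f
   exceeds f by at most \<epsilon>; shift it down by \<epsilon> / 2. *)
theory Submission
  imports Defs
begin

text \<open>To the right of a point of \<open>D\<close>, \<open>f\<close> rises by at most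
  \<epsilon>. So the supremum \<open>s x\<close> of \<open>f\<close> over the points of
  \<open>D\<close> from \<open>x\<close> onwards lies between \<open>f x\<close> and
  \<open>f x + \<epsilon>\<close>, and it decreases because the sets \<open>U x\<close> shrink as
  \<open>x\<close> grows.\<close>

theorem corollary11:
  fixes D :: "real set" and \<epsilon> :: real and f :: "real \<Rightarrow> real"
  assumes "\<epsilon> \<ge> 0"
    and "\<forall>x\<in>D. \<forall>y\<in>D. f (max x y) - min (f x) (f y) \<le> \<epsilon>"
  shows "\<exists>g :: real \<Rightarrow> real. antimono_on D g \<and> (\<forall>x\<in>D. \<bar>f x - g x\<bar> \<le> \<epsilon> / 2)"
proof -
  define U where "U x = D \<inter> {x..}" for x
  define s where "s x = (SUP y\<in>U x. f y)" for x
  \<comment> \<open>Here \<open>max x y = y\<close>, and the minimum is at most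
    \<open>f x\<close>.\<close>
  have f_le: "f y \<le> f x + \<epsilon>" if "x \<in> D" "y \<in> U x" for x y
    using assms(2)[rule_format, of x y] that by (auto simp: U_def max_def min_def split: if_splits)
  have mem: "x \<in> U x" if "x \<in> D" for x
    using that by (simp add: U_def)
  \<comment> \<open>A real \<open>SUP\<close> is meaningful only over a nonempty set of values
    bounded above; \<open>f x + \<epsilon>\<close> is such a bound.\<close>
  have bdd: "bdd_above (f ` U x)" if "x \<in> D" for x
    using f_le[OF that] by (rule bdd_aboveI2)
  have upper: "s x \<le> f x + \<epsilon>" if "x \<in> D" for x
    unfolding s_def using mem[OF that] f_le[OF that] by (intro cSUP_least) auto
  have lower: "f x \<le> s x" if "x \<in> D" for x
    unfolding s_def using mem[OF that] bdd[OF that] by (intro cSUP_upper)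
  have anti: "s y \<le> s x" if "x \<in> D" "y \<in> D" "x \<le> y" for x y
    unfolding s_def
  proof (rule cSUP_subset_mono)
    show "U y \<noteq> {}" using mem[OF \<open>y \<in> D\<close>] by blast
    show "U y \<subseteq> U x" using \<open>x \<le> y\<close> by (auto simp: U_def)
  qed (auto intro: bdd \<open>x \<in> D\<close>)
  show ?thesis
  proof (intro exI[of _ "\<lambda>x. s x - \<epsilon> / 2"] conjI ballI)
    show "antimono_on D (\<lambda>x. s x - \<epsilon> / 2)"
      using anti by (auto intro!: monotone_onI)
    \<comment> \<open>\<open>s x - f x\<close> lies in \<open>{0..\<epsilon>}\<close>; the shift
      centres this interval at 0.\<close>
    show "\<bar>f x - (s x - \<epsilon> / 2)\<bar> \<le> \<epsilon> / 2" if "x \<in> D" for x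
      using upper[OF that] lower[OF that] by (simp add: abs_le_iff field_simps)
  qed
qed

end
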